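(* Let $p,q\ge 0$ be integers and let $a_1,\dots,a_p,b_1,\dots,b_q$ be arbitrary constants. For every integer $N\ge 0$ put $$F_N(x)={}_{p+N+1}F_{q+N+1}\Bigl(a_1,\dots,a_p,\tfrac{\alpha+1}{\gamma},\tfrac{\alpha+\beta+1}{\gamma},\dots,\tfrac{\alpha+N\beta+1}{\gamma};\,b_1,\dots,b_q,\tfrac{\alpha+\gamma+1}{\gamma},\tfrac{\alpha+\gamma+\beta+1}{\gamma},\dots,\tfrac{\alpha+\gamma+N\beta+1}{\gamma};\,\lambda x^{\gamma}\Bigr).$$ Then, for any constants $\alpha,\beta,\eta,\lambda$ and any nonzero constant $\gamma$, $$\cos(\eta x^\beta)\sum_{j=0}^{\infty}\frac{(-1)^j(\beta\eta x^\beta)^{2j}}{\prod_{m=0}^{2j}(\alpha+m\beta+1)}F_{2j}(x)+\sin(\eta x^\beta)\sum_{j=0}^{\infty}\frac{(-1)^j(\beta\eta x^\beta)^{2j+1}}{\prod_{m=0}^{2j+1}(\alpha+m\beta+1)}F_{2j+1}(x)$$ $$=\frac12\left[e^{i\eta x^\beta}\sum_{j=0}^{\infty}\frac{(-i\beta\eta x^\beta)^{j}}{\prod_{m=0}^{j}(\alpha+m\beta+1)}F_{j}(x)+e^{-i\eta x^\beta}\sum_{j=0}^{\infty}\frac{(i\beta\eta x^\beta)^{j}}{\prod_{m=0}^{j}(\alpha+m\beta+1)}F_{j}(x)\right].$$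
   Context: Constants are real or complex; $i$ is the imaginary unit. The generalized hypergeometric function is defined by the series $${}_pF_q(a_1,\dots,a_p;b_1,\dots,b_q;x)=\sum_{n=0}^{\infty}\frac{(a_1)_n\cdots(a_p)_n}{(b_1)_n\cdots(b_q)_n}\frac{x^n}{n!},$$ with Pochhammer symbol $(\vartheta)_n=\Gamma(\vartheta+n)/\Gamma(\vartheta)$, $(\vartheta)_0=1$. *)

theory Defs
  imports "HOL-Analysis.Analysis"
begin

(* The value at z of the generalized hypergeometric series pFq(as; bs; z), with p = length as and
   q = length bs; see hypergeo_series. It is meaningful where the series is defined and converges. *)
definition hypergeo :: "complex list \<Rightarrow> complex list \<Rightarrow> complex \<Rightarrow> complex" where
  "hypergeo as bs z = eval_fps (fps_hypergeo as bs 1) z"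

lemma hypergeo_series:
  "hypergeo as bs z =
     (\<Sum>n. (\<Prod>a\<leftarrow>as. pochhammer a n) / (\<Prod>b\<leftarrow>bs. pochhammer b n) * (z ^ n / fact n))"
proof -
  have *: "foldr (\<lambda>a r. r * pochhammer a n) cs (v :: complex) =
             v * (\<Prod>a\<leftarrow>cs. pochhammer a n)" for cs v n
    by (induction cs) (simp_all add: mult_ac)
  show ?thesis
    by (simp add: hypergeo_def eval_fps_def fps_hypergeo_nth_alt * field_simps
             del: fps_hypergeo_nth)
qed

(* x powr w is the principal branch exp (w * Ln x) for x \<noteq> 0; for real x > 0 it is the usual power. *)
definition hypergeo_F ::
  "complex list \<Rightarrow> complex list \<Rightarrow> complex \<Rightarrow> complex \<Rightarrow> complex \<Rightarrow> complex \<Rightarrow> nat \<Rightarrow> complex \<Rightarrow> complex"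
where
  "hypergeo_F as bs \<alpha> \<beta> \<gamma> lam N x =
     hypergeo (as @ map (\<lambda>m. (\<alpha> + of_nat m * \<beta> + 1) / \<gamma>) [0..<Suc N])
              (bs @ map (\<lambda>m. (\<alpha> + \<gamma> + of_nat m * \<beta> + 1) / \<gamma>) [0..<Suc N])
              (lam * x powr \<gamma>)"

end

theory Submission
  imports Defs
begin

text \<open>
  The hypergeometric factors are inert: the identity holds with any complex sequence \<open>g\<close> in place of
  \<open>g j = t ^ j / P j * F j\<close>, where \<open>t = \<beta> * \<eta> * x powr \<beta>\<close>. Since \<open>\<i> ^ (2 * k) = (-1) ^ k\<close>,
  the series \<open>A\<close> and \<open>B\<close> with terms \<open>(- \<i>) ^ j * g j\<close> and \<open>\<i> ^ j * g j\<close> have the same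
  even-indexed terms, namely those of \<open>C\<close>, and opposite odd-indexed ones, namely \<open>\<i>\<close> times
  those of \<open>S\<close> up to sign. Spreading \<open>C\<close> and \<open>S\<close> over the even and the odd indices, padded by
  zeros, therefore gives \<open>A = C - \<i> * S\<close> and \<open>B = C + \<i> * S\<close> term by term. These two relations
  can be inverted, so \<open>C\<close> and \<open>S\<close> both converge iff \<open>A\<close> and \<open>B\<close> both do, even when the
  convergence is only conditional. Inserting the sums into the right-hand side, Euler's formula
  turns it into \<open>cos\<close> times the sum of \<open>C\<close> plus \<open>sin\<close> times the sum of \<open>S\<close>.
\<close>

text \<open>
  Padding by zeros only repeats partial sums, so no absolute convergence is needed to
  move a series to the even or to the odd indices.
\<close>

lemma sums_even_padded_iff:
  fixes f :: "nat \<Rightarrow> 'a::real_normed_vector"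
  shows "(\<lambda>n. if even n then f (n div 2) else 0) sums l \<longleftrightarrow> f sums l"
proof -
  have "strict_mono (\<lambda>k::nat. 2 * k)"
    by (simp add: strict_mono_def)
  moreover have "(if even n then f (n div 2) else 0) = 0" if "n \<notin> range (\<lambda>k. 2 * k)" for n
    using that by (auto elim!: evenE)
  ultimately have "(\<lambda>k. if even (2 * k) then f ((2 * k) div 2) else 0) sums l \<longleftrightarrow>
      (\<lambda>n. if even n then f (n div 2) else 0) sums l"
    by (rule sums_mono_reindex)
  then show ?thesis
    by simp
qed

lemma sums_odd_padded_iff:
  fixes f :: "nat \<Rightarrow> 'a::real_normed_vector"
  shows "(\<lambda>n. if odd n then f (n div 2) else 0) sums l \<longleftrightarrow> f sums l"
proof -
  have "strict_mono (\<lambda>k::nat. 2 * k + 1)"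
    by (simp add: strict_mono_def)
  moreover have "(if odd n then f (n div 2) else 0) = 0" if "n \<notin> range (\<lambda>k. 2 * k + 1)" for n
    using that by (auto elim!: oddE)
  ultimately have "(\<lambda>k. if odd (2 * k + 1) then f ((2 * k + 1) div 2) else 0) sums l \<longleftrightarrow>
      (\<lambda>n. if odd n then f (n div 2) else 0) sums l"
    by (rule sums_mono_reindex)
  then show ?thesis
    by simp
qed

lemma imaginary_unit_power_split:
  fixes g :: "nat \<Rightarrow> complex"
  defines "E \<equiv> \<lambda>n. if even n then (-1) ^ (n div 2) * g (2 * (n div 2)) else 0"
    and "D \<equiv> \<lambda>n. if odd n then (-1) ^ (n div 2) * g (2 * (n div 2) + 1) else 0"
  shows "\<i> ^ n * g n = E n + \<i> * D n" and "(- \<i>) ^ n * g n = E n - \<i> * D n"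
proof -
  have "\<i> ^ n * g n = E n + \<i> * D n \<and> (- \<i>) ^ n * g n = E n - \<i> * D n"
  proof (cases "even n")
    case True
    then obtain k where "n = 2 * k" by (elim evenE)
    then show ?thesis by (simp add: E_def D_def power_mult)
  next
    case False
    then obtain k where "n = 2 * k + 1" by (elim oddE)
    then show ?thesis by (simp add: E_def D_def power_mult)
  qed
  then show "\<i> ^ n * g n = E n + \<i> * D n" and "(- \<i>) ^ n * g n = E n - \<i> * D n"
    by auto
qed

text \<open>
  The case \<open>g n = z ^ n / fact n\<close> is Euler's formula, with \<open>c = cos z\<close> and \<open>s = sin z\<close>.
\<close>

lemma sums_imaginary_unit_powers:
  fixes g :: "nat \<Rightarrow> complex"
  assumes "(\<lambda>k. (-1) ^ k * g (2 * k)) sums c" and "(\<lambda>k. (-1) ^ k * g (2 * k + 1)) sums s"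
  shows "(\<lambda>n. \<i> ^ n * g n) sums (c + \<i> * s)" and "(\<lambda>n. (- \<i>) ^ n * g n) sums (c - \<i> * s)"
proof -
  note E = assms(1)[THEN sums_even_padded_iff[THEN iffD2]]
  note D = assms(2)[THEN sums_odd_padded_iff[THEN iffD2], THEN sums_mult, of \<i>]
  show "(\<lambda>n. \<i> ^ n * g n) sums (c + \<i> * s)"
    unfolding imaginary_unit_power_split by (rule sums_add[OF E D])
  show "(\<lambda>n. (- \<i>) ^ n * g n) sums (c - \<i> * s)"
    unfolding imaginary_unit_power_split by (rule sums_diff[OF E D])
qed

lemma summable_imaginary_unit_powers_iff:
  fixes g :: "nat \<Rightarrow> complex"
  shows "summable (\<lambda>k. (-1) ^ k * g (2 * k)) \<and> summable (\<lambda>k. (-1) ^ k * g (2 * k + 1)) \<longleftrightarrow>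
         summable (\<lambda>n. (- \<i>) ^ n * g n) \<and> summable (\<lambda>n. \<i> ^ n * g n)"
    (is "?C \<and> ?S \<longleftrightarrow> ?A \<and> ?B")
proof
  assume "?C \<and> ?S"
  then show "?A \<and> ?B"
    using sums_imaginary_unit_powers unfolding summable_def by blast
next
  assume "?A \<and> ?B"
  then obtain a b where a: "(\<lambda>n. (- \<i>) ^ n * g n) sums a" and b: "(\<lambda>n. \<i> ^ n * g n) sums b"
    unfolding summable_def by blast
  \<comment> \<open>Half the sum of the two series is the even part,
    half their difference is \<open>\<i>\<close> times the odd part.\<close>
  have "(\<lambda>n. if even n then (-1) ^ (n div 2) * g (2 * (n div 2)) else 0) sums ((b + a) / 2)"
    using sums_divide[OF sums_add[OF b a], of 2]
    unfolding imaginary_unit_power_split by simp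
  then have "?C"
    using sums_even_padded_iff[of "\<lambda>k. (-1) ^ k * g (2 * k)"] sums_summable by blast
  moreover have
    "(\<lambda>n. if odd n then (-1) ^ (n div 2) * g (2 * (n div 2) + 1) else 0) sums ((b - a) / (2 * \<i>))"
    using sums_divide[OF sums_diff[OF b a], of "2 * \<i>"]
    unfolding imaginary_unit_power_split by simp
  then have "?S"
    using sums_odd_padded_iff[of "\<lambda>k. (-1) ^ k * g (2 * k + 1)"] sums_summable by blast
  ultimately show "?C \<and> ?S" ..
qed

lemma cos_sin_combination_eq_exp:
  fixes \<theta> c s :: complex
  shows "cos \<theta> * c + sin \<theta> * s =
         1/2 * (exp (\<i> * \<theta>) * (c - \<i> * s) + exp (- (\<i> * \<theta>)) * (c + \<i> * s))"
  unfolding exp_Euler exp_minus_Euler by (simp add: algebra_simps)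

theorem theorem4:
  fixes as bs :: "complex list" and \<alpha> \<beta> \<gamma> \<eta> lam x :: complex
  assumes "\<gamma> \<noteq> 0"
  shows
    "let F = hypergeo_F as bs \<alpha> \<beta> \<gamma> lam;
         P = (\<lambda>N. \<Prod>m=0..N. \<alpha> + of_nat m * \<beta> + 1);
         C = (\<lambda>j. (-1) ^ j * (\<beta> * \<eta> * x powr \<beta>) ^ (2*j) / P (2*j) * F (2*j) x);
         S = (\<lambda>j. (-1) ^ j * (\<beta> * \<eta> * x powr \<beta>) ^ (2*j+1) / P (2*j+1) * F (2*j+1) x);
         A = (\<lambda>j. (- \<i> * \<beta> * \<eta> * x powr \<beta>) ^ j / P j * F j x);
         B = (\<lambda>j. (\<i> * \<beta> * \<eta> * x powr \<beta>) ^ j / P j * F j x)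
     in (summable C \<and> summable S \<longleftrightarrow> summable A \<and> summable B) \<and>
        (summable C \<and> summable S \<longrightarrow>
           cos (\<eta> * x powr \<beta>) * (\<Sum>j. C j) + sin (\<eta> * x powr \<beta>) * (\<Sum>j. S j)
           = 1/2 * (exp (\<i> * \<eta> * x powr \<beta>) * (\<Sum>j. A j)
                    + exp (- \<i> * \<eta> * x powr \<beta>) * (\<Sum>j. B j)))"
proof -
  define \<theta> where "\<theta> = \<eta> * x powr \<beta>"
  define g where "g = (\<lambda>j. (\<beta> * \<eta> * x powr \<beta>) ^ j / (\<Prod>m=0..j. \<alpha> + of_nat m * \<beta> + 1) *
                           hypergeo_F as bs \<alpha> \<beta> \<gamma> lam j x)"
  have C: "(-1) ^ j * (\<beta> * \<eta> * x powr \<beta>) ^ k / (\<Prod>m=0..k. \<alpha> + of_nat m * \<beta> + 1) *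
             hypergeo_F as bs \<alpha> \<beta> \<gamma> lam k x = (-1) ^ j * g k" for j k
    by (simp add: g_def)
  have A: "(u * \<beta> * \<eta> * x powr \<beta>) ^ j / (\<Prod>m=0..j. \<alpha> + of_nat m * \<beta> + 1) *
             hypergeo_F as bs \<alpha> \<beta> \<gamma> lam j x = u ^ j * g j" for u j
    by (simp add: g_def power_mult_distrib)
  have \<theta>: "\<i> * \<eta> * x powr \<beta> = \<i> * \<theta>" "- \<i> * \<eta> * x powr \<beta> = - (\<i> * \<theta>)"
    by (simp_all add: \<theta>_def)
  have "cos \<theta> * (\<Sum>k. (-1) ^ k * g (2 * k)) + sin \<theta> * (\<Sum>k. (-1) ^ k * g (2 * k + 1)) =
        1/2 * (exp (\<i> * \<theta>) * (\<Sum>n. (- \<i>) ^ n * g n) + exp (- (\<i> * \<theta>)) * (\<Sum>n. \<i> ^ n * g n))"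
    if "summable (\<lambda>k. (-1) ^ k * g (2 * k))" "summable (\<lambda>k. (-1) ^ k * g (2 * k + 1))"
    using sums_imaginary_unit_powers[OF that[THEN summable_sums], THEN sums_unique, symmetric]
    by (simp only: cos_sin_combination_eq_exp)
  then show ?thesis
    unfolding Let_def C A \<theta> \<theta>_def[symmetric]
    using summable_imaginary_unit_powers_iff[of g] by blast
qed

end
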